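(* Let $\mathcal{G}$ be a hereditary class of graphs such that every graph in $\mathcal{G}$ is diamond-free. If every prime graph in $\mathcal{G}$ is recolorable, then every graph in $\mathcal{G}$ is recolorable.
   Context: Graphs are finite and simple. A class is hereditary if closed under induced subgraphs. The diamond is $K_4$ minus one edge; a graph is diamond-free if it has no induced diamond. A $k$-coloring of $G$ is a map $V(G)\to\{1,\dots,k\}$ giving adjacent vertices different colors; $\chi(G)$ is the chromatic number. $R_\ell(G)$ is the graph whose vertices are the $\ell$-colorings of $G$, two adjacent if they differ on exactly one vertex. $G$ is recolorable if $R_\ell(G)$ is connected for every $\ell\ge\chi(G)+1$. A module is a non-empty $S\subseteq V(G)$ such that every vertex outside $S$ is adjacent to all or none of $S$; it is non-trivial if it is a proper subset of $V(G)$ with at least two vertices; $G$ is prime if it has no non-trivial module. *)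

theory Defs
  imports "Graph_Theory.Pair_Digraph" "Graph_Theory.Digraph_Component"
    "Graph_Theory.Digraph_Isomorphism" "HOL-Library.FuncSet"
begin

text \<open>
  A finite simple graph is a \<^locale>\<open>pair_graph\<close>: a finite symmetric loopless digraph
  without parallel arcs, an edge \<open>uv\<close> being the two arcs \<open>(u, v)\<close> and \<open>(v, u)\<close>. The graph without
  vertices is allowed. A class of graphs is a set of graphs on vertices of an arbitrary type; it is
  not required to be closed under isomorphism.
\<close>

definition graph_class :: "'a pair_pre_digraph set \<Rightarrow> bool" where
  "graph_class \<G> \<longleftrightarrow> (\<forall>G\<in>\<G>. pair_graph G)"

definition hereditary :: "'a pair_pre_digraph set \<Rightarrow> bool" where
  "hereditary \<G> \<longleftrightarrow>
     (\<forall>G\<in>\<G>. \<forall>H. induced_subgraph (with_proj H) (with_proj G) \<longrightarrow> H \<in> \<G>)"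

definition diamond :: "nat pair_pre_digraph" where
  "diamond = \<lparr> pverts = {..<4},
               parcs = {(u, v). u < 4 \<and> v < 4 \<and> u \<noteq> v} - {(0, 1), (1, 0)} \<rparr>"

definition diamond_free :: "'a pair_pre_digraph \<Rightarrow> bool" where
  "diamond_free G \<longleftrightarrow>
     \<not> (\<exists>H. induced_subgraph (with_proj H) (with_proj G)
            \<and> digraph_iso (with_proj H) (with_proj diamond))"

text \<open>
  Colorings are extensional functions (\<open>undefined\<close> outside the vertex set), so that two colorings
  are equal exactly if they agree on all vertices.
\<close>

definition is_coloring :: "nat \<Rightarrow> 'a pair_pre_digraph \<Rightarrow> ('a \<Rightarrow> nat) \<Rightarrow> bool" where
  "is_coloring k G c \<longleftrightarrow>
     c \<in> pverts G \<rightarrow>\<^sub>E {1..k} \<and> (\<forall>(u, v) \<in> parcs G. c u \<noteq> c v)"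

definition chromatic_number :: "'a pair_pre_digraph \<Rightarrow> nat" where
  "chromatic_number G = (LEAST k. \<exists>c. is_coloring k G c)"

definition recoloring_graph :: "nat \<Rightarrow> 'a pair_pre_digraph \<Rightarrow> ('a \<Rightarrow> nat) pair_pre_digraph" where
  "recoloring_graph l G =
     \<lparr> pverts = {c. is_coloring l G c},
       parcs = {(c, d). is_coloring l G c \<and> is_coloring l G d \<and> (\<exists>!v. v \<in> pverts G \<and> c v \<noteq> d v)} \<rparr>"

definition recolorable :: "'a pair_pre_digraph \<Rightarrow> bool" where
  "recolorable G \<longleftrightarrow>
     (\<forall>l \<ge> chromatic_number G + 1. Digraph_Component.connected (with_proj (recoloring_graph l G)))"

definition is_module :: "'a pair_pre_digraph \<Rightarrow> 'a set \<Rightarrow> bool" where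
  "is_module G S \<longleftrightarrow> S \<noteq> {} \<and> S \<subseteq> pverts G \<and>
     (\<forall>v \<in> pverts G - S. (\<forall>s\<in>S. (v, s) \<in> parcs G) \<or> (\<forall>s\<in>S. (v, s) \<notin> parcs G))"

definition nontrivial_module :: "'a pair_pre_digraph \<Rightarrow> 'a set \<Rightarrow> bool" where
  "nontrivial_module G S \<longleftrightarrow> is_module G S \<and> S \<subset> pverts G \<and> card S \<ge> 2"

definition prime_graph :: "'a pair_pre_digraph \<Rightarrow> bool" where
  "prime_graph G \<longleftrightarrow> \<not> (\<exists>S. nontrivial_module G S)"

lemma pair_graph_diamond: "pair_graph diamond"
proof -
  have "finite (parcs diamond)"
    by (rule finite_subset[of _ "{..<4} \<times> {..<4}"]) (auto simp: diamond_def)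
  then show ?thesis
    by unfold_locales (auto simp: diamond_def symmetric_def sym_def)
qed

text \<open>The minimum defining the chromatic number is attained.\<close>

lemma ex_coloring:
  assumes "pair_graph G"
  shows "\<exists>c. is_coloring (chromatic_number G) G c"
proof -
  interpret pair_graph G by fact
  obtain f where f: "bij_betw f (pverts G) {1..card (pverts G)}"
    using pair_finite_verts by (metis finite_same_card_bij finite_atLeastAtMost card_atLeastAtMost diff_Suc_1)
  have "is_coloring (card (pverts G)) G (restrict f (pverts G))"
    unfolding is_coloring_def using f in_arcsD1 in_arcsD2 no_loops'
    by (auto simp: bij_betw_def inj_on_def) blast+
  then show ?thesis
    unfolding chromatic_number_def
    by (intro LeastI[of "\<lambda>k. \<exists>c. is_coloring k G c"] exI)
qed

end

theory Submission
  imports Defs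
begin

text \<open>
  By induction on the number of vertices. Let \<open>M\<close> be a non-trivial module of a diamond-free graph
  \<open>G\<close>. If \<open>M\<close> is stable, two of its vertices \<open>x\<close>, \<open>y\<close> are false twins, and a recoloring sequence of
  \<open>G - x\<close> lifts to \<open>G\<close> by letting \<open>x\<close> follow \<open>y\<close>. If \<open>M\<close> has no neighbour outside, \<open>G\<close> is a
  disjoint union. Otherwise \<open>M\<close> contains an edge \<open>ab\<close>, and diamond-freeness makes the outside
  neighbours of \<open>M\<close> a clique and then the whole neighbourhood of \<open>a\<close> a clique. So \<open>a\<close> has degree
  at most \<open>\<chi>(G) - 1\<close>, and with \<open>\<chi>(G) + 1\<close> colors it can always be moved out of the way of a
  neighbour that is about to be recolored.
\<close>

section \<open>Induced subgraphs\<close>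

definition induced_on :: "'a pair_pre_digraph \<Rightarrow> 'a set \<Rightarrow> 'a pair_pre_digraph" where
  "induced_on G S = \<lparr> pverts = S, parcs = parcs G \<inter> S \<times> S \<rparr>"

lemma induced_on_simps [simp]:
  "pverts (induced_on G S) = S"
  "parcs (induced_on G S) = parcs G \<inter> S \<times> S"
  by (simp_all add: induced_on_def)

lemma pair_graph_induced_on:
  assumes "pair_graph G" "S \<subseteq> pverts G"
  shows "pair_graph (induced_on G S)"
proof -
  interpret pair_graph G by fact
  show ?thesis
    using assms(2) finite_subset[OF assms(2) pair_finite_verts] pair_finite_arcs
    by unfold_locales (auto simp: symmetric_def sym_def arcs_symmetric dest: no_loops')
qed

lemma induced_subgraph_induced_on:
  assumes "pair_graph G" "S \<subseteq> pverts G"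
  shows "induced_subgraph (with_proj (induced_on G S)) (with_proj G)"
proof -
  interpret pair_graph G by fact
  interpret H: pair_graph "induced_on G S" using assms by (rule pair_graph_induced_on)
  show ?thesis
    unfolding induced_subgraph_def subgraph_def compatible_def
    using assms(2) wf_digraph H.wf_digraph by auto
qed

text \<open>Otherwise \<open>a\<close>, \<open>b\<close>, \<open>p\<close>, \<open>q\<close> would
  induce a diamond whose missing edge is \<open>ab\<close>. Diamond-freeness enters the proof only
  in this form.\<close>

lemma diamond_free_adjacent:
  assumes G: "pair_graph G" "diamond_free G"
    and arcs: "(a, p) \<in> parcs G" "(a, q) \<in> parcs G" "(b, p) \<in> parcs G" "(b, q) \<in> parcs G"
      "(p, q) \<in> parcs G" and "a \<noteq> b"
  shows "(a, b) \<in> parcs G"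
proof (rule ccontr)
  assume nab: "(a, b) \<notin> parcs G"
  interpret pair_graph G by fact
  define H where "H = induced_on G {a, b, p, q}"
  have sub: "{a, b, p, q} \<subseteq> pverts G"
    using arcs in_arcsD1 in_arcsD2 by blast
  interpret H: pair_graph H unfolding H_def using G(1) sub by (rule pair_graph_induced_on)
  have dist: "a \<noteq> p" "a \<noteq> q" "b \<noteq> p" "b \<noteq> q" "p \<noteq> q"
    using arcs no_loops' by blast+
  \<comment> \<open>The non-adjacent pair goes to 0 and 1, the two vertices between which
    \<open>diamond\<close> has no edge.\<close>
  define f :: "'a \<Rightarrow> nat" where
    "f = (\<lambda>x. if x = a then 0 else if x = b then 1 else if x = p then 2 else 3)"
  have f: "f a = 0" "f b = 1" "f p = 2" "f q = 3"
    using dist \<open>a \<noteq> b\<close> by (auto simp: f_def)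
  have inj: "inj_on f {a, b, p, q}"
    using f by (auto simp: inj_on_def)
  have parcs_H: "parcs H = {(a, p), (p, a), (a, q), (q, a), (b, p), (p, b), (b, q), (q, b), (p, q), (q, p)}"
    unfolding H_def using arcs arcs_symmetric nab no_loops' by auto
  have four: "{..<4::nat} = {0, 1, 2, 3}"
    by auto
  have less_four: "u < 4 \<longleftrightarrow> u = 0 \<or> u = 1 \<or> u = 2 \<or> u = 3" for u :: nat
    by auto
  have parcs_diamond: "map_prod f f ` parcs H = parcs diamond"
    unfolding parcs_H diamond_def by (auto simp: f less_four)
  \<comment> \<open>\<open>with_proj\<close> takes \<open>fst\<close> and \<open>snd\<close> as tail
    and head, so arcs are mapped componentwise and the projections are kept.\<close>
  define h where "h = \<lparr> iso_verts = f, iso_arcs = map_prod f f, iso_head = snd, iso_tail = fst \<rparr>"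
  have "inj_on (map_prod f f) (parcs H)"
    by (rule inj_on_subset[OF map_prod_inj_on[OF inj inj]]) (auto simp: H_def)
  then have "pre_digraph.digraph_isomorphism (with_proj H) h"
    unfolding pre_digraph.digraph_isomorphism_def h_def
    using H.wf_digraph inj by (auto simp: H_def)
  moreover have "with_proj diamond = app_iso h (with_proj H)"
    unfolding app_iso_def
    using parcs_diamond f by (simp add: h_def with_proj_def H_def) (auto simp: diamond_def four)
  ultimately have "digraph_iso (with_proj H) (with_proj diamond)"
    unfolding digraph_iso_def by blast
  moreover have "induced_subgraph (with_proj H) (with_proj G)"
    unfolding H_def using G(1) sub by (rule induced_subgraph_induced_on)
  ultimately show False
    using G(2) unfolding diamond_free_def by blast
qed

section \<open>Recoloring sequences\<close>

lemma is_coloring_mono: "is_coloring k G c \<Longrightarrow> k \<le> l \<Longrightarrow> is_coloring l G c"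
  by (fastforce simp: is_coloring_def PiE_iff)

lemma is_coloring_induced_on:
  "is_coloring l G c \<Longrightarrow> S \<subseteq> pverts G \<Longrightarrow> is_coloring l (induced_on G S) (restrict c S)"
  by (fastforce simp: is_coloring_def PiE_iff)

lemma is_coloring_arc: "is_coloring l G c \<Longrightarrow> (u, v) \<in> parcs G \<Longrightarrow> c u \<noteq> c v"
  by (auto simp: is_coloring_def)

lemma is_coloring_range: "is_coloring l G c \<Longrightarrow> v \<in> pverts G \<Longrightarrow> c v \<in> {1..l}"
  by (auto simp: is_coloring_def)

lemma chromatic_number_induced_on_le:
  assumes "pair_graph G" "S \<subseteq> pverts G"
  shows "chromatic_number (induced_on G S) \<le> chromatic_number G"
proof -
  obtain c where "is_coloring (chromatic_number G) G c"
    using ex_coloring[OF assms(1)] by blast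
  then have "is_coloring (chromatic_number G) (induced_on G S) (restrict c S)"
    using assms(2) by (rule is_coloring_induced_on)
  then show ?thesis
    unfolding chromatic_number_def[of "induced_on G S"] by (blast intro: Least_le)
qed

abbreviation recolor_steps :: "nat \<Rightarrow> 'a pair_pre_digraph \<Rightarrow> (('a \<Rightarrow> nat) \<times> ('a \<Rightarrow> nat)) set" where
  "recolor_steps l G \<equiv> (parcs (recoloring_graph l G))\<^sup>*"

text \<open>The arcs of the recoloring graph are symmetric and stay inside its vertex set, so
  connectedness is reachability along arcs. Connectedness also demands a vertex; one exists because
  an optimal coloring is an \<open>l\<close>-coloring.\<close>

lemma recolorable_iff:
  assumes "pair_graph G"
  shows "recolorable G \<longleftrightarrow> (\<forall>l \<ge> chromatic_number G + 1. \<forall>c d.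
    is_coloring l G c \<longrightarrow> is_coloring l G d \<longrightarrow> (c, d) \<in> recolor_steps l G)"
proof -
  have "Digraph_Component.connected (with_proj (recoloring_graph l G)) \<longleftrightarrow>
    (\<forall>c d. is_coloring l G c \<longrightarrow> is_coloring l G d \<longrightarrow> (c, d) \<in> recolor_steps l G)"
    if l: "l \<ge> chromatic_number G + 1" for l
  proof -
    let ?R = "recoloring_graph l G"
    have wf: "pair_wf_digraph ?R"
      by unfold_locales (auto simp: recoloring_graph_def)
    interpret R: pair_wf_digraph ?R by fact
    have sym: "symcl (parcs ?R) = parcs ?R"
      unfolding symcl_def recoloring_graph_def by auto
    have cl: "(c, d) \<in> rtrancl_on (pverts ?R) (parcs ?R) \<longleftrightarrow> (c, d) \<in> recolor_steps l G"
      if "c \<in> pverts ?R" "d \<in> pverts ?R" for c d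
    proof
      show "(c, d) \<in> rtrancl_on (pverts ?R) (parcs ?R) \<Longrightarrow> (c, d) \<in> recolor_steps l G"
        by (rule rtrancl_on_rtranclI)
      show "(c, d) \<in> recolor_steps l G \<Longrightarrow> (c, d) \<in> rtrancl_on (pverts ?R) (parcs ?R)"
        using that R.in_arcsD1 R.in_arcsD2 by (intro rtrancl_consistent_rtrancl_on) auto
    qed
    obtain c where "is_coloring (chromatic_number G) G c"
      using ex_coloring[OF assms] by blast
    then have "is_coloring l G c"
      by (rule is_coloring_mono) (use l in simp)
    then have ne: "pverts ?R \<noteq> {}"
      by (auto simp: recoloring_graph_def)
    have verts: "c \<in> pverts ?R \<longleftrightarrow> is_coloring l G c" for c
      by (simp add: recoloring_graph_def)
    show ?thesis
      unfolding connected_conv with_proj_simps sym using ne cl verts by blast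
  qed
  then show ?thesis
    unfolding recolorable_def by blast
qed

text \<open>Both colorings are \<open>undefined\<close> outside the graph, so colorings that differ
  at a single vertex are equal as functions up to one update.\<close>

lemma recoloring_arcE:
  assumes "(c, d) \<in> parcs (recoloring_graph l G)"
  obtains v k where "v \<in> pverts G" "d = c(v := k)" "is_coloring l G c" "is_coloring l G d"
proof -
  from assms have cd: "is_coloring l G c" "is_coloring l G d"
    and "\<exists>!v. v \<in> pverts G \<and> c v \<noteq> d v"
    by (simp_all add: recoloring_graph_def)
  then obtain v where v: "v \<in> pverts G"
    and uniq: "\<And>w. w \<in> pverts G \<Longrightarrow> c w \<noteq> d w \<Longrightarrow> w = v"
    by (elim ex1E) blast
  have "d = c(v := d v)"
  proof
    fix w
    show "d w = (c(v := d v)) w"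
    proof (cases "w \<in> pverts G")
      case True
      then show ?thesis using uniq[of w] by (metis fun_upd_apply)
    next
      case False
      then have "c w = undefined" "d w = undefined"
        using cd unfolding is_coloring_def by (blast intro: PiE_arb)+
      then show ?thesis using False v by auto
    qed
  qed
  with v show thesis
    using cd by (rule that)
qed

text \<open>The move may be void: if \<open>c v = k\<close>, the empty sequence does. Callers thus
  never check that a color really changes.\<close>

lemma recolor_steps_update:
  assumes "is_coloring l G c" "is_coloring l G (c(v := k))" "v \<in> pverts G"
  shows "(c, c(v := k)) \<in> recolor_steps l G"
proof (cases "c v = k")
  case False
  then have "(c, c(v := k)) \<in> parcs (recoloring_graph l G)"
    using assms by (auto simp: recoloring_graph_def)
  then show ?thesis by blast
qed (auto simp: fun_upd_idem)

lemma is_coloring_update: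
  assumes "pair_graph G" "is_coloring l G c" "v \<in> pverts G" "k \<in> {1..l}"
    "\<And>u. (v, u) \<in> parcs G \<Longrightarrow> c u \<noteq> k"
  shows "is_coloring l G (c(v := k))"
proof -
  interpret pair_graph G by fact
  have "(c(v := k)) u \<noteq> (c(v := k)) w" if "(u, w) \<in> parcs G" for u w
    using that assms(2,5) no_loops'[OF that] arcs_symmetric[OF that]
    by (auto simp: is_coloring_def)
  moreover have "c(v := k) \<in> pverts G \<rightarrow>\<^sub>E {1..l}"
    using assms(2-4) by (auto simp: is_coloring_def PiE_iff extensional_def)
  ultimately show ?thesis
    unfolding is_coloring_def by (auto simp del: fun_upd_apply)
qed

section \<open>Reductions\<close>

text \<open>A sequence on \<open>G - x\<close> is lifted move by move: before a neighbour
  \<open>v\<close> of \<open>x\<close> takes color \<open>k\<close>, \<open>x\<close> steps aside to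
  a color other than \<open>k\<close> that no neighbour of \<open>x\<close> has. The assumption
  \<open>free\<close> provides that color for every move to which only \<open>x\<close> can
  object.\<close>

lemma recolorable_extend_vertex:
  assumes G: "pair_graph G" and x: "x \<in> pverts G"
    and rec: "recolorable (induced_on G (pverts G - {x}))"
    and free: "\<And>l c v k. \<lbrakk>chromatic_number G + 1 \<le> l; is_coloring l G c; (x, v) \<in> parcs G;
        \<And>w. (v, w) \<in> parcs G \<Longrightarrow> w \<noteq> x \<Longrightarrow> c w \<noteq> k\<rbrakk>
      \<Longrightarrow> \<exists>j\<in>{1..l}. j \<noteq> k \<and> (\<forall>u. (x, u) \<in> parcs G \<longrightarrow> c u \<noteq> j)"
  shows "recolorable G"
proof -
  interpret pair_graph G by fact
  define S where "S = pverts G - {x}"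
  define H where "H = induced_on G S"
  have S: "S \<subseteq> pverts G" by (auto simp: S_def)
  have H: "pair_graph H" unfolding H_def using G S by (rule pair_graph_induced_on)
  have "(c, d) \<in> recolor_steps l G"
    if l: "chromatic_number G + 1 \<le> l" and c: "is_coloring l G c" and d: "is_coloring l G d" for l c d
  proof -
    \<comment> \<open>Each coloring on the way is the restriction to \<open>S\<close> of a reachable
      coloring of \<open>G\<close>; the color of \<open>x\<close> is left open and corrected at the
      end.\<close>
    have lift: "\<exists>c'. (c, c') \<in> recolor_steps l G \<and> is_coloring l G c' \<and> restrict c' S = b"
      if "(restrict c S, b) \<in> recolor_steps l H" for b
      using that
    proof (induction rule: rtrancl_induct)
      case base
      then show ?case using c by blast
    next
      case (step a b)
      from step.IH obtain e where e: "(c, e) \<in> recolor_steps l G" "is_coloring l G e" "restrict e S = a"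
        by blast
      from step.hyps(2) obtain v k where v: "v \<in> S" and b: "b = a(v := k)" "is_coloring l H b"
        by (rule recoloring_arcE) (simp add: H_def)
      have vG: "v \<in> pverts G" and vx: "v \<noteq> x"
        using v by (auto simp: S_def)
      have k: "k \<in> {1..l}"
        using is_coloring_range[OF b(2), of v] v b(1) by (simp add: H_def)
      \<comment> \<open>After the move, \<open>b\<close> is proper on \<open>S\<close>, so only
        \<open>x\<close> can conflict with the new color \<open>k\<close>.\<close>
      have away: "e w \<noteq> k" if "(v, w) \<in> parcs G" "w \<noteq> x" for w
      proof -
        have w: "w \<in> S" using that in_arcsD2 by (auto simp: S_def)
        then have "b v \<noteq> b w"
          using that v by (intro is_coloring_arc[OF b(2)]) (simp add: H_def)
        moreover have "w \<noteq> v" using that no_loops' by blast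
        ultimately show ?thesis
          using w by (auto simp: b(1) e(3)[symmetric])
      qed
      obtain j where j: "j \<in> {1..l}" "\<And>u. (x, u) \<in> parcs G \<Longrightarrow> e u \<noteq> j" "(x, v) \<in> parcs G \<Longrightarrow> j \<noteq> k"
      proof (cases "(x, v) \<in> parcs G")
        case True
        then show thesis using free[OF l e(2) True away] that by blast
      next
        case False
        \<comment> \<open>Here \<open>x\<close> does not obstruct the move and keeps its
          color.\<close>
        then show thesis
          using that[of "e x"] is_coloring_range[OF e(2) x] is_coloring_arc[OF e(2)] by metis
      qed
      let ?e = "e(x := j)"
      have e': "is_coloring l G ?e"
        using is_coloring_update[OF G e(2) x j(1,2)] .
      have e'': "is_coloring l G (?e(v := k))"
      proof (rule is_coloring_update[OF G e' vG k])
        fix u assume "(v, u) \<in> parcs G"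
        then show "?e u \<noteq> k"
          using away[of u] j(3) arcs_symmetric[of v u] by auto
      qed
      have "(c, ?e(v := k)) \<in> recolor_steps l G"
        using e(1) recolor_steps_update[OF e(2) e' x] recolor_steps_update[OF e' e'' vG]
        by (meson rtrancl_trans)
      moreover have "restrict (?e(v := k)) S = b"
        using v by (auto simp: b(1) e(3)[symmetric] S_def fun_eq_iff)
      ultimately show ?case using e'' by blast
    qed
    have "chromatic_number H + 1 \<le> l"
      using chromatic_number_induced_on_le[OF G S] l unfolding H_def by simp
    then have "(restrict c S, restrict d S) \<in> recolor_steps l H"
      using rec recolorable_iff[OF H] is_coloring_induced_on[OF c S] is_coloring_induced_on[OF d S]
      unfolding H_def S_def by blast
    from lift[OF this] obtain c' where c': "(c, c') \<in> recolor_steps l G" "is_coloring l G c'"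
      "restrict c' S = restrict d S"
      by blast
    \<comment> \<open>\<open>c'\<close> and \<open>d\<close> agree off \<open>x\<close>, so one
      recoloring of \<open>x\<close> finishes; it is legal since its result is the coloring
      \<open>d\<close>.\<close>
    have "d = c'(x := d x)"
    proof
      fix w
      show "d w = (c'(x := d x)) w"
        using c'(2) d fun_cong[OF c'(3), of w]
        by (cases "w \<in> pverts G") (auto simp: S_def is_coloring_def PiE_iff extensional_def)
    qed
    then show ?thesis
      using c'(1) recolor_steps_update[OF c'(2) _ x, of "d x"] d by (metis rtrancl_trans)
  qed
  then show ?thesis
    using recolorable_iff[OF G] by blast
qed

text \<open>The color of \<open>y\<close> serves \<open>x\<close>: \<open>y\<close> has the same
  neighbours as \<open>x\<close>, and as a neighbour of \<open>v\<close> other than \<open>x\<close>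
  it does not have color \<open>k\<close>.\<close>

lemma recolorable_extend_false_twin:
  assumes G: "pair_graph G" and xy: "x \<in> pverts G" "y \<in> pverts G" "x \<noteq> y"
    and twin: "\<And>u. (x, u) \<in> parcs G \<longleftrightarrow> (y, u) \<in> parcs G"
    and rec: "recolorable (induced_on G (pverts G - {x}))"
  shows "recolorable G"
proof (rule recolorable_extend_vertex[OF G xy(1) rec])
  interpret pair_graph G by fact
  fix l c v k
  assume c: "is_coloring l G c" and v: "(x, v) \<in> parcs G"
    and k: "\<And>w. (v, w) \<in> parcs G \<Longrightarrow> w \<noteq> x \<Longrightarrow> c w \<noteq> k"
  have "c y \<noteq> k"
    using k[of y] v twin arcs_symmetric xy(3) by blast
  then show "\<exists>j\<in>{1..l}. j \<noteq> k \<and> (\<forall>u. (x, u) \<in> parcs G \<longrightarrow> c u \<noteq> j)"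
    using is_coloring_range[OF c xy(2)] is_coloring_arc[OF c] twin by metis
qed

text \<open>\<open>x\<close> and its neighbours form a clique, on which an optimal coloring is
  injective, so \<open>x\<close> has at most \<open>chromatic_number G - 1\<close> neighbours. Their
  colors together with \<open>k\<close> cannot exhaust \<open>l\<close> colors.\<close>

lemma recolorable_extend_simplicial:
  assumes G: "pair_graph G" and x: "x \<in> pverts G"
    and clique: "\<And>p q. \<lbrakk>(x, p) \<in> parcs G; (x, q) \<in> parcs G; p \<noteq> q\<rbrakk> \<Longrightarrow> (p, q) \<in> parcs G"
    and rec: "recolorable (induced_on G (pverts G - {x}))"
  shows "recolorable G"
proof (rule recolorable_extend_vertex[OF G x rec])
  interpret pair_graph G by fact
  let ?N = "{u. (x, u) \<in> parcs G}"
  have N: "?N \<subseteq> pverts G" "finite ?N" "x \<notin> ?N"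
    using in_arcsD2 no_loops' finite_subset[OF _ pair_finite_verts, of ?N] by blast+
  obtain f where f: "is_coloring (chromatic_number G) G f"
    using ex_coloring[OF G] by blast
  have "inj_on f (insert x ?N)"
    using clique arcs_symmetric is_coloring_arc[OF f] unfolding inj_on_def by blast
  then have "card (insert x ?N) \<le> card {1..chromatic_number G}"
    using is_coloring_range[OF f] N(1) x by (intro card_inj_on_le) auto
  then have card_N: "Suc (card ?N) \<le> chromatic_number G"
    using N by simp
  fix l k :: nat and c :: "'a \<Rightarrow> nat" and v
  assume l: "chromatic_number G + 1 \<le> l"
  have "card (insert k (c ` ?N)) \<le> Suc (card (c ` ?N))"
    using N(2) by (simp add: card_insert_if)
  also have "\<dots> \<le> Suc (card ?N)"
    using N(2) by (simp add: card_image_le)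
  \<comment> \<open>The color beyond \<open>chromatic_number G\<close> makes this strict:
    \<open>k\<close> and the neighbours may use up \<open>chromatic_number G\<close> colors.\<close>
  also have "\<dots> < card {1..l}"
    using card_N l by simp
  finally have "\<not> {1..l} \<subseteq> insert k (c ` ?N)"
    using N(2) card_mono[of "insert k (c ` ?N)" "{1..l}"] by auto
  then show "\<exists>j\<in>{1..l}. j \<noteq> k \<and> (\<forall>u. (x, u) \<in> parcs G \<longrightarrow> c u \<noteq> j)"
    by blast
qed

text \<open>No arc leaves \<open>S\<close>, so a sequence on \<open>S\<close> can be replayed in
  \<open>G\<close> with all other colors frozen. Properness is carried along because each next move
  relies on it.\<close>

lemma recolor_steps_closed_part:
  assumes G: "pair_graph G" and S: "S \<subseteq> pverts G"
    and closed: "\<And>u v. (u, v) \<in> parcs G \<Longrightarrow> u \<in> S \<Longrightarrow> v \<in> S"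
    and c: "is_coloring l G c"
    and steps: "(restrict c S, b) \<in> recolor_steps l (induced_on G S)"
  shows "(c, override_on c b S) \<in> recolor_steps l G \<and> is_coloring l G (override_on c b S)"
  using steps
proof (induction rule: rtrancl_induct)
  case base
  have "override_on c (restrict c S) S = c"
    by (auto simp: override_on_def)
  then show ?case using c by (simp only: rtrancl.rtrancl_refl)
next
  case (step a b)
  interpret pair_graph G by fact
  let ?a = "override_on c a S"
  from step.hyps(2) obtain v k where v: "v \<in> S" and b: "b = a(v := k)"
    "is_coloring l (induced_on G S) b"
    by (rule recoloring_arcE) simp
  have k: "k \<in> {1..l}"
    using is_coloring_range[OF b(2), of v] v b(1) by simp
  have upd: "override_on c b S = ?a(v := k)"
    using v by (auto simp: b(1) override_on_def)
  have "is_coloring l G (?a(v := k))"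
  proof (rule is_coloring_update[OF G _ _ k])
    fix u assume u: "(v, u) \<in> parcs G"
    then have "u \<in> S" "u \<noteq> v"
      using closed v no_loops' by blast+
    then show "?a u \<noteq> k"
      using is_coloring_arc[OF b(2), of v u] u v by (auto simp: b(1))
  qed (use step.IH v S in auto)
  then show ?case
    unfolding upd using step.IH v S recolor_steps_update[of l G ?a v k]
    by (meson rtrancl_trans subsetD)
qed

text \<open>First \<open>S\<close> is recolored to its target, then the complement. Both parts have
  chromatic number at most that of \<open>G\<close>, so \<open>l\<close> is admissible for
  each.\<close>

lemma recolorable_disjoint_union:
  assumes G: "pair_graph G" and S: "S \<subseteq> pverts G"
    and closed: "\<And>u v. (u, v) \<in> parcs G \<Longrightarrow> u \<in> S \<longleftrightarrow> v \<in> S"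
    and rec: "recolorable (induced_on G S)" "recolorable (induced_on G (pverts G - S))"
  shows "recolorable G"
proof -
  interpret pair_graph G by fact
  let ?T = "pverts G - S"
  have T: "?T \<subseteq> pverts G" by blast
  have closed_T: "v \<in> ?T" if "(u, v) \<in> parcs G" "u \<in> ?T" for u v
    using that closed in_arcsD2 by blast
  have part: "(restrict c U, restrict d U) \<in> recolor_steps l (induced_on G U)"
    if "recolorable (induced_on G U)" "U \<subseteq> pverts G" "chromatic_number G + 1 \<le> l"
      "is_coloring l G c" "is_coloring l G d" for U l c d
  proof -
    have "chromatic_number (induced_on G U) + 1 \<le> l"
      using chromatic_number_induced_on_le[OF G that(2)] that(3) by simp
    then show ?thesis
      using that recolorable_iff[OF pair_graph_induced_on[OF G that(2)]] is_coloring_induced_on by blast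
  qed
  have "(c, d) \<in> recolor_steps l G"
    if l: "chromatic_number G + 1 \<le> l" and c: "is_coloring l G c" and d: "is_coloring l G d" for l c d
  proof -
    let ?e = "override_on c (restrict d S) S"
    have e: "(c, ?e) \<in> recolor_steps l G" "is_coloring l G ?e"
      using recolor_steps_closed_part[OF G S _ c part[OF rec(1) S l c d]] closed by blast+
    have "(?e, override_on ?e (restrict d ?T) ?T) \<in> recolor_steps l G"
      using recolor_steps_closed_part[OF G T _ e(2) part[OF rec(2) T l e(2) d]] closed_T by blast
    moreover have "override_on ?e (restrict d ?T) ?T = d"
    proof
      fix w
      show "override_on ?e (restrict d ?T) ?T w = d w"
        using c d S
        by (cases "w \<in> pverts G") (auto simp: override_on_def is_coloring_def PiE_iff extensional_def)
    qed
    ultimately show ?thesis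
      using e(1) by (metis rtrancl_trans)
  qed
  then show ?thesis
    using recolorable_iff[OF G] by blast
qed

section \<open>The induction step\<close>

text \<open>Two vertices in \<open>M\<close> supply the twins of the stable case; properness of
  \<open>M\<close> makes both parts smaller graphs when no edge leaves \<open>M\<close>.\<close>

lemma recolorable_nontrivial_module:
  assumes G: "pair_graph G" "diamond_free G" and M: "nontrivial_module G M"
    and rec: "\<And>S. S \<subset> pverts G \<Longrightarrow> recolorable (induced_on G S)"
  shows "recolorable G"
proof -
  interpret pair_graph G by fact
  have sub: "M \<subset> pverts G" and card_M: "2 \<le> card M" and ne: "M \<noteq> {}"
    using M by (auto simp: nontrivial_module_def is_module_def)
  have module: "(v, s) \<in> parcs G \<longleftrightarrow> (v, t) \<in> parcs G" if "v \<notin> M" "s \<in> M" "t \<in> M" for v s t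
    using M that in_arcsD1 unfolding nontrivial_module_def is_module_def by blast
  have module': "(s, v) \<in> parcs G \<longleftrightarrow> (t, v) \<in> parcs G" if "v \<notin> M" "s \<in> M" "t \<in> M" for v s t
    using module[OF that] arcs_symmetric by blast
  have rec_vertex: "recolorable (induced_on G (pverts G - {x}))" if "x \<in> M" for x
    using that sub by (intro rec) blast
  \<comment> \<open>In the case \<open>edge\<close>, the module property makes \<open>n\<close>
    adjacent to all of \<open>M\<close>.\<close>
  consider (stable) "\<And>a b. a \<in> M \<Longrightarrow> b \<in> M \<Longrightarrow> (a, b) \<notin> parcs G"
    | (component) "\<And>u v. (u, v) \<in> parcs G \<Longrightarrow> u \<in> M \<longleftrightarrow> v \<in> M"
    | (edge) a b n where "a \<in> M" "b \<in> M" "(a, b) \<in> parcs G" "n \<notin> M" "(a, n) \<in> parcs G"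
  proof (cases "\<exists>u v. (u, v) \<in> parcs G \<and> \<not> (u \<in> M \<longleftrightarrow> v \<in> M)")
    case False
    then show thesis using component by blast
  next
    case True
    then obtain s n where sn: "s \<in> M" "n \<notin> M" "(s, n) \<in> parcs G"
      using arcs_symmetric by blast
    show thesis
    proof (cases "\<exists>a b. a \<in> M \<and> b \<in> M \<and> (a, b) \<in> parcs G")
      case False
      then show thesis using stable by blast
    next
      case True
      then obtain a b where ab: "a \<in> M" "b \<in> M" "(a, b) \<in> parcs G"
        by blast
      then have "(a, n) \<in> parcs G"
        using module'[OF sn(2,1)] sn(3) by blast
      then show thesis using edge ab sn(2) by blast
    qed
  qed
  then show ?thesis
  proof cases
    case stable
    have "finite M"
      using sub pair_finite_verts finite_subset by blast
    then obtain x y where xy: "x \<in> M" "y \<in> M" "x \<noteq> y"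
      using card_M card_le_Suc0_iff_eq[of M] by auto
    have "(x, u) \<in> parcs G \<longleftrightarrow> (y, u) \<in> parcs G" for u
      using stable xy module'[of u x y] by (cases "u \<in> M") simp_all
    then show ?thesis
      using xy sub
      by (intro recolorable_extend_false_twin[OF G(1) _ _ xy(3) _ rec_vertex[OF xy(1)]]) auto
  next
    case component
    show ?thesis
      by (rule recolorable_disjoint_union[OF G(1) _ component rec rec]) (use sub ne in auto)
  next
    case (edge a b n)
    \<comment> \<open>If \<open>q\<close> lies in \<open>M\<close>, then \<open>p\<close> is
      adjacent to it as it is to \<open>a\<close>. Otherwise \<open>a\<close> and \<open>b\<close>
      are adjacent common neighbours of \<open>p\<close> and \<open>q\<close>, so a missing edge
      \<open>pq\<close> would give a diamond.\<close>
    have outer: "(p, q) \<in> parcs G"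
      if "(a, p) \<in> parcs G" "(a, q) \<in> parcs G" "p \<noteq> q" "p \<notin> M" for p q
    proof (cases "q \<in> M")
      case True
      then show ?thesis using that module[of p a q] edge(1) arcs_symmetric by blast
    next
      case False
      then have "(b, p) \<in> parcs G" "(b, q) \<in> parcs G"
        using that module'[OF _ edge(1,2)] by blast+
      then show ?thesis
        using that edge(3) by (intro diamond_free_adjacent[OF G, of p a b q]) (simp_all add: arcs_symmetric)
    qed
    \<comment> \<open>Two neighbours of \<open>a\<close> inside \<open>M\<close> have the adjacent
      common neighbours \<open>a\<close> and \<open>n\<close>. In all other cases
      \<open>outer\<close> applies, with \<open>p\<close> and \<open>q\<close> swapped if
      necessary.\<close>
    have "(p, q) \<in> parcs G" if pq: "(a, p) \<in> parcs G" "(a, q) \<in> parcs G" "p \<noteq> q" for p q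
    proof (cases "p \<in> M \<and> q \<in> M")
      case True
      then have "(p, n) \<in> parcs G" "(q, n) \<in> parcs G"
        using module'[OF edge(4) edge(1)] edge(5) by blast+
      then show ?thesis
        using pq edge(5) by (intro diamond_free_adjacent[OF G, of p a n q]) (simp_all add: arcs_symmetric)
    next
      case False
      then show ?thesis using pq outer[of p q] outer[of q p] arcs_symmetric by blast
    qed
    then show ?thesis
      using edge(1) sub
      by (intro recolorable_extend_simplicial[OF G(1) _ _ rec_vertex[OF edge(1)]]) auto
  qed
qed

theorem theorem12:
  fixes \<G> :: "'a pair_pre_digraph set"
  assumes "graph_class \<G>"
    and "hereditary \<G>"
    and "\<And>G. G \<in> \<G> \<Longrightarrow> diamond_free G"
    and "\<And>G. G \<in> \<G> \<Longrightarrow> prime_graph G \<Longrightarrow> recolorable G"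
  shows "\<forall>G\<in>\<G>. recolorable G"
proof
  fix G assume "G \<in> \<G>"
  then show "recolorable G"
  proof (induction "card (pverts G)" arbitrary: G rule: less_induct)
    case less
    have G: "pair_graph G"
      using assms(1) less.prems by (auto simp: graph_class_def)
    interpret pair_graph G by fact
    \<comment> \<open>Heredity returns every proper induced subgraph to the class, where the
      induction hypothesis covers it.\<close>
    have rec: "recolorable (induced_on G S)" if S: "S \<subset> pverts G" for S
    proof (rule less.hyps)
      show "card (pverts (induced_on G S)) < card (pverts G)"
        using psubset_card_mono[OF pair_finite_verts S] by simp
      show "induced_on G S \<in> \<G>"
        using assms(2) less.prems induced_subgraph_induced_on[OF G] S unfolding hereditary_def by blast
    qed
    show ?case
    proof (cases "prime_graph G")
      case True
      then show ?thesis using assms(4) less.prems by blast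
    next
      case False
      then obtain M where "nontrivial_module G M"
        unfolding prime_graph_def by blast
      then show ?thesis
        using recolorable_nontrivial_module[OF G assms(3)[OF less.prems]] rec by blast
    qed
  qed
qed

end
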